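(* Let $\Lambda \subset \mathbb{R}^m$ be an $n$-dimensional lattice with obtuse superbasis $b_1,\dots,b_{n+1}$, let $B = (b_1\; b_2\; \cdots\; b_{n+1})$ be the matrix with these columns, let $z \in \mathbb{R}^{n+1}$ and let $y = Bz$. Define $u_0 = \lfloor z \rfloor$ and, for $k = 0,1,2,\dots$, let $t_k$ be any minimiser of $\|B(z - u_k - t)\|^2$ over $t \in \{0,1\}^{n+1}$, and put $u_{k+1} = u_k + t_k$. Let $x_k = B u_k$ for all $k \geq 0$. Then there exists an integer $K$ with $0 \le K \leq n$ such that $x_K$ is a closest lattice point to $y$.
   Context: An $n$-dimensional lattice $\Lambda \subset \mathbb{R}^m$ ($m \ge n$) is the set of all integer linear combinations of $n$ linearly independent vectors (a basis) of $\mathbb{R}^m$. An obtuse superbasis of $\Lambda$ is a list of $n+1$ vectors $b_1,\dots,b_{n+1}$ such that $b_1,\dots,b_n$ is a basis of $\Lambda$, $b_1 + \dots + b_{n+1} = \mathbf{0}$, and $b_i \cdot b_j \leq 0$ for all $i \neq j$; a lattice having one is said to be of Voronoi's first kind. $\|\cdot\|$ is the Euclidean norm. A closest lattice point to $y$ is an $x \in \Lambda$ minimising $\|y - x\|$ over $\Lambda$. $\lfloor z \rfloor$ is the elementwise floor (largest integer less than or equal to each element). $\{0,1\}^{n+1}$ is the set of column vectors of length $n+1$ with entries $0$ or $1$. The minimisers $t_k$ need not be unique; any one may be chosen. *)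

theory Defs
  imports "HOL-Analysis.Analysis"
begin

text \<open>
  Lists of vectors are families indexed by a set. Injectivity on the index set together with
  independence of the image is linear independence of the list.
\<close>

definition lattice_basis :: "'i set \<Rightarrow> ('i \<Rightarrow> 'v::real_vector) \<Rightarrow> 'v set \<Rightarrow> bool" where
  "lattice_basis I b \<Lambda> \<longleftrightarrow>
     finite I \<and> inj_on b I \<and> independent (b ` I) \<and>
     \<Lambda> = {(\<Sum>i\<in>I. of_int (c i) *\<^sub>R b i) | c :: 'i \<Rightarrow> int. True}"

definition lattice_of_dim :: "nat \<Rightarrow> 'v::real_vector set \<Rightarrow> bool" where
  "lattice_of_dim n \<Lambda> \<longleftrightarrow> (\<exists>b :: nat \<Rightarrow> 'v. lattice_basis {1..n} b \<Lambda>)"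

text \<open>
  The \<open>n + 1\<close> indices form a finite type \<open>'k\<close>; the marked index \<open>l\<close> plays the role of the last
  index \<open>n + 1\<close>, so the remaining \<open>n\<close> vectors are the ones required to be a basis.
\<close>

definition obtuse_superbasis ::
    "'k::finite \<Rightarrow> ('k \<Rightarrow> 'v::real_inner) \<Rightarrow> 'v set \<Rightarrow> bool" where
  "obtuse_superbasis l b \<Lambda> \<longleftrightarrow>
     lattice_basis (UNIV - {l}) b \<Lambda> \<and>
     (\<Sum>i\<in>UNIV. b i) = 0 \<and>
     (\<forall>i j. i \<noteq> j \<longrightarrow> b i \<bullet> b j \<le> 0)"

definition closest_lattice_point :: "'v::real_normed_vector set \<Rightarrow> 'v \<Rightarrow> 'v \<Rightarrow> bool" where
  "closest_lattice_point \<Lambda> y x \<longleftrightarrow> is_arg_min (\<lambda>x'. norm (y - x')) (\<lambda>x'. x' \<in> \<Lambda>) x"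

definition floor_vec :: "real ^ 'k \<Rightarrow> real ^ 'k" where
  "floor_vec z = (\<chi> i. of_int \<lfloor>z $ i\<rfloor>)"

definition zero_one_vecs :: "(real ^ 'k) set" where
  "zero_one_vecs = {t. \<forall>i. t $ i \<in> {0, 1}}"

end

theory Submission
  imports Defs
begin

text \<open>
  By Selling's formula, \<open>\<parallel>B p\<parallel>\<^sup>2 = 1/2 \<Sum>\<^sub>i\<^sub>j (- b\<^sub>i \<bullet> b\<^sub>j) (p\<^sub>i - p\<^sub>j)\<^sup>2\<close>, so for an obtuse superbasis the
  objective, as a function of the integer coordinates, is submodular and invariant under adding a
  constant to all coordinates. If such a function has a global minimiser \<open>v\<close> with
  \<open>u \<le> v \<le> u + r\<close>, then after a best \<open>{0,1}\<close>-step \<open>t\<close> from \<open>u\<close> it has one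
  with \<open>u + t \<le> v' \<le> u + t + (r - 1)\<close>; hence \<open>r\<close> steps reach a global minimiser. Starting from
  \<open>\<lfloor>z\<rfloor>\<close> one may take \<open>r = n\<close>: if the values of \<open>v - \<lfloor>z\<rfloor>\<close> skip a level, lowering all
  coordinates above that level by one does not increase the objective, and the \<open>n + 1\<close> coordinates
  can only occupy the levels \<open>0, \<dots>, n\<close>.
\<close>

section \<open>Submodularity of the energy on integer coordinates\<close>

text \<open>Ordered pairs are summed, so for \<open>w i j = - (b i \<bullet> b j)\<close> with the
  \<open>b i\<close> summing to zero the value is twice the squared norm of
  \<open>B (z - v)\<close>. Diagonal terms vanish, so only the off-diagonal signs of
  \<open>w\<close> matter.\<close>

definition pair_energy :: "('k::finite \<Rightarrow> 'k \<Rightarrow> real) \<Rightarrow> ('k \<Rightarrow> real) \<Rightarrow> ('k \<Rightarrow> int) \<Rightarrow> real" where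
  "pair_energy w z v = (\<Sum>i\<in>UNIV. \<Sum>j\<in>UNIV. w i j * ((z i - v i) - (z j - v j))\<^sup>2)"

lemma pair_energy_shift: "pair_energy w z (\<lambda>i. v i + c) = pair_energy w z v"
  unfolding pair_energy_def by (simp add: algebra_simps)

text \<open>If \<open>(a, b)\<close> and \<open>(c, d)\<close> are comparable, max and min merely
  permute them. Otherwise the differences on the left have the same sum as those on the right and
  lie between them, so convexity of the square applies.\<close>

lemma square_diff_submodular:
  fixes e a b c d :: real
  shows "(e - (max a c - max b d))\<^sup>2 + (e - (min a c - min b d))\<^sup>2
    \<le> (e - (a - b))\<^sup>2 + (e - (c - d))\<^sup>2"
proof -
  have crossed: "(e - (p - s))\<^sup>2 + (e - (r - q))\<^sup>2 \<le> (e - (p - q))\<^sup>2 + (e - (r - s))\<^sup>2"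
    if "r \<le> p" "q \<le> s" for p q r s :: real
  proof -
    have "0 \<le> (p - r) * (s - q)" using that by simp
    then show ?thesis by (simp add: power2_eq_square algebra_simps)
  qed
  show ?thesis
    using crossed[of c a b d] crossed[of a c d b]
    by (cases "a \<le> c"; cases "b \<le> d") (auto simp: max_def min_def)
qed

lemma pair_energy_submodular:
  assumes "\<And>i j. i \<noteq> j \<Longrightarrow> 0 \<le> w i j"
  shows "pair_energy w z (\<lambda>i. max (p i) (q i)) + pair_energy w z (\<lambda>i. min (p i) (q i))
    \<le> pair_energy w z p + pair_energy w z q"
proof -
  have "w i j * ((z i - max (p i) (q i)) - (z j - max (p j) (q j)))\<^sup>2
      + w i j * ((z i - min (p i) (q i)) - (z j - min (p j) (q j)))\<^sup>2
    \<le> w i j * ((z i - p i) - (z j - p j))\<^sup>2 + w i j * ((z i - q i) - (z j - q j))\<^sup>2" for i j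
  proof (cases "i = j")
    case False
    have regroup: "(z i - x) - (z j - y) = (z i - z j) - (x - y)" for x y by simp
    show ?thesis
      unfolding regroup of_int_max of_int_min distrib_left[symmetric]
      by (rule mult_left_mono[OF square_diff_submodular assms[OF False]])
  qed simp
  then show ?thesis
    unfolding pair_energy_def sum.distrib[symmetric]
    by (intro sum_mono)
qed

section \<open>Reduction to a finite box\<close>

text \<open>Only pairs on opposite sides of the missed level \<open>c\<close> change. Their levels
  differ by at least 2 and their fractional parts by less than 1, so moving one of them by 1 towards
  the other shrinks the difference.\<close>

lemma pair_energy_lower_above_gap:
  assumes w: "\<And>i j. i \<noteq> j \<Longrightarrow> 0 \<le> w i j"
    and gap: "\<And>i. v i - \<lfloor>z i\<rfloor> \<noteq> c"
  shows "pair_energy w z (\<lambda>i. v i - of_bool (c < v i - \<lfloor>z i\<rfloor>)) \<le> pair_energy w z v"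
proof -
  define v' where "v' = (\<lambda>i. v i - of_bool (c < v i - \<lfloor>z i\<rfloor>))"
  have crossing: "\<bar>(z i - v' i) - (z j - v' j)\<bar> \<le> \<bar>(z i - v i) - (z j - v j)\<bar>"
    if "c < v i - \<lfloor>z i\<rfloor>" "\<not> c < v j - \<lfloor>z j\<rfloor>" for i j
  proof -
    have "c + 1 \<le> v i - \<lfloor>z i\<rfloor>" "v j - \<lfloor>z j\<rfloor> \<le> c - 1"
      using that gap[of j] by linarith+
    then have "(v j - \<lfloor>z j\<rfloor>) + 2 \<le> v i - \<lfloor>z i\<rfloor>" by linarith
    then have "real_of_int (v j) - \<lfloor>z j\<rfloor> + 2 \<le> real_of_int (v i) - \<lfloor>z i\<rfloor>" by linarith
    moreover have "z i < \<lfloor>z i\<rfloor> + 1" "\<lfloor>z j\<rfloor> \<le> z j" by linarith+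
    ultimately have "(z i - v i) - (z j - v j) < - 1" by linarith
    then show ?thesis using that by (simp add: v'_def)
  qed
  have "((z i - v' i) - (z j - v' j))\<^sup>2 \<le> ((z i - v i) - (z j - v j))\<^sup>2" for i j
    unfolding abs_le_square_iff[symmetric]
    using crossing[of i j] crossing[of j i]
    by (cases "c < v i - \<lfloor>z i\<rfloor>"; cases "c < v j - \<lfloor>z j\<rfloor>")
      (auto simp: abs_minus_commute v'_def)
  moreover have "w i j * ((z i - v' i) - (z j - v' j))\<^sup>2 \<le> w i j * ((z i - v i) - (z j - v j))\<^sup>2"
    if "((z i - v' i) - (z j - v' j))\<^sup>2 \<le> ((z i - v i) - (z j - v j))\<^sup>2" for i j
    using that w[of i j] by (cases "i = j") (auto intro: mult_left_mono)
  ultimately show ?thesis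
    unfolding v'_def[symmetric] pair_energy_def by (intro sum_mono) auto
qed

text \<open>Pigeonhole: apart from \<open>d j\<close> itself, \<open>d\<close> takes fewer than
  \<open>CARD('k)\<close> values, too few to fill \<open>{0..<d j}\<close>.\<close>

lemma exists_missed_level:
  fixes d :: "'k::finite \<Rightarrow> int"
  assumes "CARD('k) \<le> d j"
  obtains c where "0 \<le> c" "c < d j" "c \<notin> range d"
proof -
  have "card (range d - {d j}) < CARD('k)"
    by (meson UNIV_I card_Diff1_less card_image_le finite finite_imageI order_less_le_trans
      rangeI)
  also have "\<dots> \<le> card {0..<d j}" using assms by simp
  finally have "\<not> {0..<d j} \<subseteq> range d - {d j}"
    by (meson card_mono finite finite_Diff finite_imageI not_le)
  then show thesis using that by force
qed

text \<open>While some level is too high, lower everything above a missed level \<open>c\<close>.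
  The sum of the levels drops each time, and \<open>0 \<le> c\<close> keeps all levels
  nonnegative.\<close>

lemma pair_energy_reduce_to_box:
  fixes w :: "'k::finite \<Rightarrow> 'k \<Rightarrow> real"
  assumes w: "\<And>i j. i \<noteq> j \<Longrightarrow> 0 \<le> w i j"
    and "\<And>i. \<lfloor>z i\<rfloor> \<le> v i"
  shows "\<exists>v'. (\<forall>i. \<lfloor>z i\<rfloor> \<le> v' i \<and> v' i < \<lfloor>z i\<rfloor> + CARD('k)) \<and>
    pair_energy w z v' \<le> pair_energy w z v"
  using assms(2)
proof (induction "nat (\<Sum>i\<in>UNIV. v i - \<lfloor>z i\<rfloor>)" arbitrary: v rule: less_induct)
  case less
  show ?case
  proof (cases "\<forall>i. v i < \<lfloor>z i\<rfloor> + CARD('k)")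
    case True
    then show ?thesis using less.prems by blast
  next
    case False
    then obtain j where "\<not> v j < \<lfloor>z j\<rfloor> + CARD('k)" by blast
    then have "CARD('k) \<le> v j - \<lfloor>z j\<rfloor>" by linarith
    then obtain c where c: "0 \<le> c" "c < v j - \<lfloor>z j\<rfloor>" "c \<notin> range (\<lambda>i. v i - \<lfloor>z i\<rfloor>)"
      by (rule exists_missed_level)
    define v' where "v' = (\<lambda>i. v i - of_bool (c < v i - \<lfloor>z i\<rfloor>))"
    have le: "\<lfloor>z i\<rfloor> \<le> v' i" for i
      using less.prems[of i] c(1) by (simp add: v'_def)
    have "(\<Sum>i\<in>UNIV. v' i - \<lfloor>z i\<rfloor>) < (\<Sum>i\<in>UNIV. v i - \<lfloor>z i\<rfloor>)"
      by (rule sum_strict_mono_ex1) (use c(2) in \<open>auto simp: v'_def\<close>)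
    moreover have "0 \<le> (\<Sum>i\<in>UNIV. v' i - \<lfloor>z i\<rfloor>)"
      by (rule sum_nonneg) (use le in simp)
    ultimately obtain v'' where "\<forall>i. \<lfloor>z i\<rfloor> \<le> v'' i \<and> v'' i < \<lfloor>z i\<rfloor> + CARD('k)"
      "pair_energy w z v'' \<le> pair_energy w z v'"
      using less.hyps[of v'] le by auto
    moreover have "pair_energy w z v' \<le> pair_energy w z v"
      unfolding v'_def using w c(3) by (intro pair_energy_lower_above_gap) auto
    ultimately show ?thesis by (meson order_trans)
  qed
qed

text \<open>
  Reduction to a finite box also gives the existence of a global minimum, without appealing to
  discreteness of the lattice.
\<close>

lemma pair_energy_minimiser_in_box:
  fixes w :: "'k::finite \<Rightarrow> 'k \<Rightarrow> real"
  assumes w: "\<And>i j. i \<noteq> j \<Longrightarrow> 0 \<le> w i j"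
  obtains v where "\<And>i. \<lfloor>z i\<rfloor> \<le> v i" "\<And>i. v i < \<lfloor>z i\<rfloor> + CARD('k)"
    "\<And>p. pair_energy w z v \<le> pair_energy w z p"
proof -
  define box where "box = Pi\<^sub>E UNIV (\<lambda>i. {\<lfloor>z i\<rfloor>..<\<lfloor>z i\<rfloor> + CARD('k)})"
  have "finite box" unfolding box_def by (rule finite_PiE) auto
  moreover have "(\<lambda>i. \<lfloor>z i\<rfloor>) \<in> box" by (auto simp: box_def)
  ultimately obtain v where v: "v \<in> box" "\<And>p. p \<in> box \<Longrightarrow> pair_energy w z v \<le> pair_energy w z p"
    using ex_is_arg_min_if_finite[of box "pair_energy w z"]
    by (auto simp: is_arg_min_linorder)
  have "pair_energy w z v \<le> pair_energy w z p" for p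
  proof -
    \<comment> \<open>A constant shift large enough to lift \<open>p\<close> above the floor; it
      leaves the energy unchanged.\<close>
    define s where "s = (\<Sum>i\<in>UNIV. \<bar>\<lfloor>z i\<rfloor> - p i\<bar>)"
    have "\<bar>\<lfloor>z i\<rfloor> - p i\<bar> \<le> s" for i
      unfolding s_def by (rule member_le_sum) auto
    then have "\<lfloor>z i\<rfloor> \<le> p i + s" for i
      by (smt (verit))
    from pair_energy_reduce_to_box[where w = w and z = z and v = "\<lambda>i. p i + s", OF w this]
    obtain p' where p': "\<forall>i. \<lfloor>z i\<rfloor> \<le> p' i \<and> p' i < \<lfloor>z i\<rfloor> + CARD('k)"
      "pair_energy w z p' \<le> pair_energy w z (\<lambda>i. p i + s)" by blast
    then have "p' \<in> box" by (auto simp: box_def)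
    with v(2) p'(2) show ?thesis unfolding pair_energy_shift by (meson order_trans)
  qed
  moreover have "\<lfloor>z i\<rfloor> \<le> v i \<and> v i < \<lfloor>z i\<rfloor> + CARD('k)" for i
    using v(1) by (simp add: box_def PiE_iff)
  ultimately show thesis using that[of v] by blast
qed

section \<open>Descent by best 0/1 steps\<close>

text \<open>Two exchanges: the minimiser \<open>v\<close> is raised to at least \<open>u'\<close>,
  then capped at \<open>u' + r\<close>. Each time optimality of \<open>u'\<close> bounds one of max
  and min from below, and submodularity bounds the other from above.\<close>

lemma submodular_best_step_approaches_minimiser:
  fixes F :: "('k \<Rightarrow> int) \<Rightarrow> real" and r :: nat
  assumes submod: "\<And>p q. F (\<lambda>i. max (p i) (q i)) + F (\<lambda>i. min (p i) (q i)) \<le> F p + F q"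
    and shift: "\<And>p c. F (\<lambda>i. p i + c) = F p"
    and min: "\<And>p. F v \<le> F p"
    and v: "\<And>i. u i \<le> v i" "\<And>i. v i \<le> u i + int (Suc r)"
    and u': "\<And>i. u' i \<in> {u i, u i + 1}"
    and best: "\<And>p. (\<And>i. p i \<in> {u i, u i + 1}) \<Longrightarrow> F u' \<le> F p"
  obtains v' where "\<And>p. F v' \<le> F p" "\<And>i. u' i \<le> v' i" "\<And>i. v' i \<le> u' i + int r"
proof -
  define v1 where "v1 = (\<lambda>i. max (v i) (u' i))"
  define v2 where "v2 = (\<lambda>i. min (v1 i - int r) (u' i))"
  have "F u' \<le> F (\<lambda>i. min (v i) (u' i))"
    by (rule best) (use u' v(1) in \<open>smt (verit) insert_iff singletonD\<close>)
  with submod[of v u'] have "F v1 \<le> F v" unfolding v1_def by simp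
  moreover have "F u' \<le> F (\<lambda>i. max (v1 i - int r) (u' i))"
  \<comment> \<open>Both \<open>v\<close> and \<open>u'\<close> are at most
    \<open>u + r + 1\<close>, so after the shift by \<open>r\<close> the maximum exceeds
    \<open>u\<close> by at most 1.\<close>
  proof (rule best)
    show "max (v1 i - int r) (u' i) \<in> {u i, u i + 1}" for i
      using u'[of i] v(2)[of i] unfolding v1_def by auto
  qed
  with submod[of "\<lambda>i. v1 i - int r" u'] have "F v2 \<le> F (\<lambda>i. v1 i - int r)"
    unfolding v2_def by simp
  moreover have "F (\<lambda>i. v1 i - int r) = F v1"
    using shift[of v1 "- int r"] by simp
  ultimately have "F (\<lambda>i. v2 i + int r) \<le> F v" unfolding shift by simp
  then have "F (\<lambda>i. v2 i + int r) \<le> F p" for p using min[of p] by simp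
  then show thesis by (rule that) (auto simp: v2_def v1_def)
qed

text \<open>Induction on the distance bound \<open>r\<close>; the minimiser being approached may
  change at every step, hence the generalisation over \<open>v\<close> as well as \<open>k\<close>.
  At \<open>r = 0\<close> it coincides with the iterate.\<close>

lemma submodular_descent_reaches_minimiser:
  fixes F :: "('k \<Rightarrow> int) \<Rightarrow> real" and r :: nat
  assumes submod: "\<And>p q. F (\<lambda>i. max (p i) (q i)) + F (\<lambda>i. min (p i) (q i)) \<le> F p + F q"
    and shift: "\<And>p c. F (\<lambda>i. p i + c) = F p"
    and step: "\<And>k i. u (Suc k) i \<in> {u k i, u k i + 1}"
    and best: "\<And>k p. (\<And>i. p i \<in> {u k i, u k i + 1}) \<Longrightarrow> F (u (Suc k)) \<le> F p"
    and "\<And>p. F v \<le> F p" "\<And>i. u k i \<le> v i" "\<And>i. v i \<le> u k i + int r"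
  shows "F (u (k + r)) \<le> F p"
  using assms(5-)
proof (induction r arbitrary: k v)
  case 0
  then have "v = u k" by (intro ext antisym) auto
  with 0 show ?case by simp
next
  case (Suc r)
  obtain v' where "\<And>p. F v' \<le> F p" "\<And>i. u (Suc k) i \<le> v' i" "\<And>i. v' i \<le> u (Suc k) i + int r"
    by (rule submodular_best_step_approaches_minimiser[where F = F and u = "u k" and
          u' = "u (Suc k)", OF submod shift Suc.prems(1,2) _ step best])
      (use Suc.prems(3) in blast)+
  from Suc.IH[OF this] show ?case by simp
qed

section \<open>Transfer to the lattice\<close>

text \<open>Expanding \<open>(p i - p j)\<^sup>2\<close>, the pure squares cancel because each row
  and column of the Gram matrix sums to zero; the cross terms form the norm.\<close>

lemma selling_formula:
  fixes b :: "'k::finite \<Rightarrow> 'v::real_inner"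
  assumes "(\<Sum>i\<in>UNIV. b i) = 0"
  shows "2 * (norm (\<Sum>i\<in>UNIV. p i *\<^sub>R b i))\<^sup>2
    = (\<Sum>i\<in>UNIV. \<Sum>j\<in>UNIV. - (b i \<bullet> b j) * (p i - p j)\<^sup>2)"
proof -
  have zero: "(\<Sum>j\<in>UNIV. b i \<bullet> b j) = 0" "(\<Sum>j\<in>UNIV. b j \<bullet> b i) = 0" for i
    using assms by (simp_all flip: inner_sum_right inner_sum_left)
  have rows: "(\<Sum>i\<in>UNIV. \<Sum>j\<in>UNIV. (p i)\<^sup>2 * (b i \<bullet> b j)) = 0"
    by (simp add: zero flip: sum_distrib_left)
  have columns: "(\<Sum>i\<in>UNIV. \<Sum>j\<in>UNIV. (p j)\<^sup>2 * (b i \<bullet> b j)) = 0"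
    by (subst sum.swap) (simp add: zero flip: sum_distrib_left)
  have "- (b i \<bullet> b j) * (p i - p j)\<^sup>2
    = 2 * (p i * (p j * (b i \<bullet> b j))) - (p i)\<^sup>2 * (b i \<bullet> b j) - (p j)\<^sup>2 * (b i \<bullet> b j)" for i j
    by (simp add: power2_eq_square algebra_simps)
  then have "(\<Sum>i\<in>UNIV. \<Sum>j\<in>UNIV. - (b i \<bullet> b j) * (p i - p j)\<^sup>2)
    = 2 * (\<Sum>i\<in>UNIV. \<Sum>j\<in>UNIV. p i * (p j * (b i \<bullet> b j)))"
    by (simp add: sum_subtractf rows columns sum_distrib_left)
  also have "\<dots> = 2 * (norm (\<Sum>i\<in>UNIV. p i *\<^sub>R b i))\<^sup>2"
    unfolding power2_norm_eq_inner inner_sum_left inner_sum_right by (simp add: sum_distrib_left inner_commute mult.left_commute)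
  finally show ?thesis by simp
qed

text \<open>As the \<open>b i\<close> sum to zero, subtracting \<open>c l\<close> from all
  coefficients keeps the vector and removes \<open>b l\<close>.\<close>

lemma obtuse_superbasis_lattice:
  assumes "obtuse_superbasis l b \<Lambda>"
  shows "\<Lambda> = range (\<lambda>c :: 'k::finite \<Rightarrow> int. \<Sum>i\<in>UNIV. of_int (c i) *\<^sub>R b i)"
proof -
  have L: "\<Lambda> = {\<Sum>i\<in>UNIV - {l}. of_int (c i) *\<^sub>R b i | c :: 'k \<Rightarrow> int. True}"
    and zero: "(\<Sum>i\<in>UNIV. b i) = 0"
    using assms unfolding obtuse_superbasis_def lattice_basis_def by blast+
  have drop: "(\<Sum>i\<in>UNIV. of_int (c i) *\<^sub>R b i) = (\<Sum>i\<in>UNIV - {l}. of_int (c i - c l) *\<^sub>R b i)"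
    for c :: "'k \<Rightarrow> int"
  proof -
    have "(\<Sum>i\<in>UNIV. of_int (c i) *\<^sub>R b i)
      = (\<Sum>i\<in>UNIV. of_int (c i) *\<^sub>R b i) - of_int (c l) *\<^sub>R (\<Sum>i\<in>UNIV. b i)"
      by (simp add: zero)
    also have "\<dots> = (\<Sum>i\<in>UNIV. of_int (c i - c l) *\<^sub>R b i)"
      by (simp add: scaleR_sum_right sum_subtractf scaleR_diff_left)
    also have "\<dots> = (\<Sum>i\<in>UNIV - {l}. of_int (c i - c l) *\<^sub>R b i)"
      by (subst sum.remove[of _ l]) auto
    finally show ?thesis .
  qed
  have extend: "(\<Sum>i\<in>UNIV - {l}. of_int (c i) *\<^sub>R b i)
    = (\<Sum>i\<in>UNIV. of_int ((c(l := 0)) i) *\<^sub>R b i)" for c :: "'k \<Rightarrow> int"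
    unfolding drop by (intro sum.cong) auto
  show ?thesis
  proof (intro equalityI subsetI)
    fix x assume "x \<in> \<Lambda>"
    then obtain c :: "'k \<Rightarrow> int" where "x = (\<Sum>i\<in>UNIV - {l}. of_int (c i) *\<^sub>R b i)"
      unfolding L by blast
    then show "x \<in> range (\<lambda>c :: 'k \<Rightarrow> int. \<Sum>i\<in>UNIV. of_int (c i) *\<^sub>R b i)"
      unfolding extend by (rule range_eqI[where x = "c(l := 0)"])
  next
    fix x assume "x \<in> range (\<lambda>c :: 'k \<Rightarrow> int. \<Sum>i\<in>UNIV. of_int (c i) *\<^sub>R b i)"
    then obtain c :: "'k \<Rightarrow> int" where "x = (\<Sum>i\<in>UNIV. of_int (c i) *\<^sub>R b i)"
      by (elim rangeE)
    then show "x \<in> \<Lambda>"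
      unfolding L drop by (intro CollectI exI[of _ "\<lambda>i. c i - c l"] conjI TrueI)
  qed
qed

theorem theorem5p9:
  fixes n :: nat
    and \<Lambda> :: "(real ^ 'm) set"
    and l :: "'k::finite"
    and b :: "'k \<Rightarrow> real ^ 'm"
    and B :: "real ^ 'k ^ 'm"
    and z :: "real ^ 'k"
    and y :: "real ^ 'm"
    and u t :: "nat \<Rightarrow> real ^ 'k"
    and x :: "nat \<Rightarrow> real ^ 'm"
  assumes "CARD('k) = n + 1"
    and "lattice_of_dim n \<Lambda>"
    and "obtuse_superbasis l b \<Lambda>"
    and "\<And>j. column j B = b j"
    and "y = B *v z"
    and "u 0 = floor_vec z"
    and "\<And>k. is_arg_min (\<lambda>s. (norm (B *v (z - u k - s)))\<^sup>2) (\<lambda>s. s \<in> zero_one_vecs) (t k)"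
    and "\<And>k. u (Suc k) = u k + t k"
    and "\<And>k. x k = B *v u k"
  shows "\<exists>K\<le>n. closest_lattice_point \<Lambda> y (x K)"
proof -
  define w where "w = (\<lambda>i j. - (b i \<bullet> b j))"
  define F where "F = pair_energy w (($) z)"
  \<comment> \<open>The floor loses nothing here: the iterates are shown below to be
    integral.\<close>
  define U where "U = (\<lambda>k i. \<lfloor>u k $ i\<rfloor>)"
  have zero: "(\<Sum>i\<in>UNIV. b i) = 0" and w: "\<And>i j. i \<noteq> j \<Longrightarrow> 0 \<le> w i j"
    using assms(3) by (auto simp: obtuse_superbasis_def w_def)
  have mult_B: "B *v p = (\<Sum>i\<in>UNIV. p $ i *\<^sub>R b i)" for p
    by (simp add: matrix_vector_mult_basis matrix_mult_sum scalar_mult_eq_scaleR assms(4))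
  have F: "F v = 2 * (norm (B *v (z - (\<chi> i. of_int (v i)))))\<^sup>2" for v
    unfolding F_def pair_energy_def w_def mult_B selling_formula[OF zero] by simp
  have t: "t k $ i = 0 \<or> t k $ i = 1" for k i
    using assms(7)[of k] by (auto simp: is_arg_min_def zero_one_vecs_def)
  have "u k $ i \<in> \<int>" for k i
  proof (induction k)
    case (Suc k)
    then show ?case using t[of k i] by (auto simp: assms(8))
  qed (simp add: assms(6) floor_vec_def)
  then have u: "u k = (\<chi> i. of_int (U k i))" for k
    by (simp add: U_def vec_eq_iff)
  have step: "U (Suc k) i \<in> {U k i, U k i + 1}" for k i
    using t[of k i] by (auto simp: U_def assms(8))
  have best: "F (U (Suc k)) \<le> F p" if "\<And>i. p i \<in> {U k i, U k i + 1}" for k p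
  proof -
    \<comment> \<open>The competing step, which leads from \<open>u k\<close> to
      \<open>p\<close>.\<close>
    define s where "s = (\<chi> i. of_int (p i)) - u k"
    have "s \<in> zero_one_vecs"
      using that by (auto simp: zero_one_vecs_def s_def u) (smt (verit) of_int_1 of_int_add)
    then have "(norm (B *v (z - u k - t k)))\<^sup>2 \<le> (norm (B *v (z - u k - s)))\<^sup>2"
      using assms(7)[of k] by (auto simp: is_arg_min_linorder)
    moreover have "z - u k - s = z - (\<chi> i. of_int (p i))" by (simp add: s_def)
    moreover have "z - u k - t k = z - u (Suc k)" by (simp add: assms(8))
    ultimately show ?thesis unfolding F u[of "Suc k", symmetric] by simp
  qed
  obtain v where v: "\<And>i. \<lfloor>z $ i\<rfloor> \<le> v i" "\<And>i. v i < \<lfloor>z $ i\<rfloor> + CARD('k)" "\<And>p. F v \<le> F p"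
    unfolding F_def using pair_energy_minimiser_in_box[where w = w and z = "($) z", OF w] by blast
  have U0: "U 0 i = \<lfloor>z $ i\<rfloor>" for i by (simp add: U_def assms(6) floor_vec_def)
  have min: "F (U (0 + n)) \<le> F p" for p
  proof (rule submodular_descent_reaches_minimiser[where F = F and u = U and v = v])
    show "F (\<lambda>i. max (p i) (q i)) + F (\<lambda>i. min (p i) (q i)) \<le> F p + F q" for p q
      unfolding F_def by (rule pair_energy_submodular[OF w])
    show "F (\<lambda>i. p i + c) = F p" for p c
      unfolding F_def by (rule pair_energy_shift)
    \<comment> \<open>The strict bound by \<open>CARD('k) = n + 1\<close> becomes \<open>n\<close>
      over the integers, which is the number of steps allowed.\<close>
    show "v i \<le> U 0 i + int n" for i
      using v(2)[of i] assms(1) by (simp add: U0)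
  qed (use step best v U0 in auto)
  have lattice: "\<Lambda> = range (\<lambda>c. B *v (\<chi> i. of_int (c i)))"
    using obtuse_superbasis_lattice[OF assms(3)] by (simp add: mult_B)
  have "norm (y - x n) \<le> norm (y - x')" if x': "x' \<in> \<Lambda>" for x'
  proof -
    obtain c where "x' = B *v (\<chi> i. of_int (c i))" using x' unfolding lattice by blast
    then show ?thesis
      using min[of c] unfolding F assms(5,9) u[of n]
      by (simp add: matrix_vector_mult_diff_distrib)
  qed
  moreover have "x n \<in> \<Lambda>" by (auto simp: lattice assms(9) u)
  \<comment> \<open>The witness is always \<open>K = n\<close>.\<close>
  ultimately have "closest_lattice_point \<Lambda> y (x n)"
    by (simp add: closest_lattice_point_def is_arg_min_linorder)
  then show ?thesis by blast
qed

end
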